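(* Suppose that the regularization parameter $\alpha=\alpha(h,\delta)\in\mathbb{R}$, $h,\delta>0$, satisfies $$\delta-\alpha(h,\delta)\le \inf_{B\in\mathcal{M}_0(T)}\inf\sigma(T_h(B))\quad\text{for all } h,\delta>0,\qquad\text{and}\qquad \lim_{h,\delta\to0}\alpha(h,\delta)=0.$$ Then for any given $\lambda>0$ there exists an $\varepsilon_\lambda>0$ such that $$\mathcal{M}_0(T)\subseteq \mathcal{M}_{\alpha(h,\delta)}(T_h^\delta)\subseteq\mathcal{M}_\lambda(T)$$ for all $h,\delta\in(0,\varepsilon_\lambda]$.
   Context: Let $\Omega\subset\mathbb{R}^n$, $n\in\{2,3\}$, be a bounded domain with Lipschitz boundary $\partial\Omega$ and outward unit normal $\nu$. All functions are real-valued. Put $L^\infty_+(\Omega)=\{w\in L^\infty(\Omega):\operatorname{ess\,inf}w>0\}$, $L^2_\diamond(\partial\Omega)=\{w\in L^2(\partial\Omega):\int_{\partial\Omega}w\,dS=0\}$ and $H^1_\diamond(\Omega)=\{w\in H^1(\Omega):\int_{\partial\Omega}w|_{\partial\Omega}\,dS=0\}$. For $\gamma\in L^\infty_+(\Omega)$ the Neumann-to-Dirichlet map $\Lambda(\gamma):L^2_\diamond(\partial\Omega)\to L^2_\diamond(\partial\Omega)$ is $f\mapsto u|_{\partial\Omega}$, where $u\in H^1_\diamond(\Omega)$ is the unique weak solution of $\nabla\cdot(\gamma\nabla u)=0$ in $\Omega$, $\nu\cdot\gamma\nabla u=f$ on $\partial\Omega$. It is compact and self-adjoint. Approximate models: $\{\Lambda_h(\gamma)\}_{h>0}$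 is a family of compact self-adjoint operators on $L^2_\diamond(\partial\Omega)$, given for every $\gamma\in L^\infty_+(\Omega)$, such that $\|\Lambda(\gamma)-\Lambda_h(\gamma)\|_{\mathcal{L}(L^2_\diamond(\partial\Omega))}\le\omega(h)\|\gamma\|_{L^\infty(\Omega)}$ for all $\gamma\in L^\infty_+(\Omega)$, where $\omega$ does not depend on $\gamma$ and $\lim_{h\to0}\omega(h)=0$. Noise: $\{N^\delta\}_{\delta>0}$ is a family of compact self-adjoint operators on $L^2_\diamond(\partial\Omega)$ with $\|N^\delta\|_{\mathcal{L}(L^2_\diamond(\partial\Omega))}\le\delta$, and $\Lambda_h^\delta(\gamma)=\Lambda_h(\gamma)+N^\delta$. Fix the conductivity $\gamma=\gamma_0+\kappa\chi_D$, where $\gamma_0\in C^\infty(\overline\Omega)\cap L^\infty_+(\Omega)$, $\kappa\in L^\infty_+(\Omega)$, $D$ is open with $\overline D\subseteq\Omega$, and $\chi_D$ is the characteristic function of $D$. Fix a constant $\beta>0$. For open $B\subseteq\Omega$ let $T(B)=\Lambda(\gamma_0+\beta\chi_B)-\Lambda(\gamma)$, $\;T_h(B)=\Lambda_h(\gamma_0+\beta\chi_B)-\Lambda_h(\gamma)$, $\;T_h^\delta(B)=\Lambda_h(\gamma_0+\beta\chi_B)-\Lambda_h^\delta(\gamma)$. For $S\in\{T,T_h^\delta\}$ and $\alpha\in\mathbb{R}$ let $\mathcal{M}_\alpha(S)=\{B\subseteq\Omega\text{ open ball}: S(B)+\alpha\,\mathrm{Id}\ge0\}$, where $\ge0$ is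 meant in the sense of positive semidefiniteness. $\sigma(\cdot)$ denotes the spectrum. *)

theory Defs
  imports "HOL-Probability.Essential_Supremum"
begin

section \<open>Domains and surface measure\<close>

text \<open>Near each boundary point the domain is the part of a ball lying strictly above the graph of
  a Lipschitz function over the hyperplane orthogonal to some unit vector \<open>e\<close>.\<close>

definition lipschitz_boundary :: "'a::euclidean_space set \<Rightarrow> bool" where
  "lipschitz_boundary \<Omega> \<longleftrightarrow>
     (\<forall>p\<in>frontier \<Omega>. \<exists>r>0. \<exists>e g L. norm e = 1 \<and> L-lipschitz_on {y. y \<bullet> e = 0} g \<and>
        \<Omega> \<inter> ball p r = {x \<in> ball p r. g (x - (x \<bullet> e) *\<^sub>R e) < x \<bullet> e})"

definition bounded_lipschitz_domain :: "'a::euclidean_space set \<Rightarrow> bool" where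
  "bounded_lipschitz_domain \<Omega> \<longleftrightarrow>
     open \<Omega> \<and> connected \<Omega> \<and> \<Omega> \<noteq> {} \<and> bounded \<Omega> \<and> lipschitz_boundary \<Omega>"

text \<open>The \<open>k\<close>-dimensional Hausdorff measure for \<open>k \<ge> 1\<close>, normalized so that it is surface measure on
  \<open>k\<close>-dimensional surfaces. The outer measure is a metric outer measure, hence countably additive on
  the Borel sets, so \<^const>\<open>measure_of\<close> does not degenerate here.\<close>

definition hausdorff_pre :: "nat \<Rightarrow> real \<Rightarrow> 'a::euclidean_space set \<Rightarrow> ennreal" where
  "hausdorff_pre k d A =
     (INF E\<in>{E :: nat \<Rightarrow> 'a set. A \<subseteq> (\<Union>i. E i) \<and> (\<forall>i. bounded (E i) \<and> diameter (E i) \<le> d)}.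
        \<Sum>i. ennreal (unit_ball_vol (real k) * (diameter (E i) / 2) ^ k))"

definition hausdorff_outer :: "nat \<Rightarrow> 'a::euclidean_space set \<Rightarrow> ennreal" where
  "hausdorff_outer k A = (SUP d\<in>{0<..}. hausdorff_pre k d A)"

definition hausdorff_measure :: "nat \<Rightarrow> 'a::euclidean_space measure" where
  "hausdorff_measure k = measure_of UNIV (sets borel) (hausdorff_outer k)"

definition surface :: "'a::euclidean_space set \<Rightarrow> 'a measure" where
  "surface \<Omega> = restrict_space (hausdorff_measure (DIM('a) - 1)) (frontier \<Omega>)"

section \<open>Lebesgue spaces\<close>

text \<open>Elements of Lebesgue spaces are represented by functions; equality is equality almost
  everywhere, and operators are maps on representatives that are linear and bounded up to null sets
  (so that they respect equality almost everywhere).\<close>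

definition L2 :: "'a measure \<Rightarrow> ('a \<Rightarrow> 'b::euclidean_space) set" where
  "L2 M = {f. f \<in> borel_measurable M \<and> integrable M (\<lambda>x. (norm (f x))\<^sup>2)}"

definition L2_inner :: "'a measure \<Rightarrow> ('a \<Rightarrow> 'b::euclidean_space) \<Rightarrow> ('a \<Rightarrow> 'b) \<Rightarrow> real" where
  "L2_inner M f g = (\<integral>x. f x \<bullet> g x \<partial>M)"

definition L2_norm :: "'a measure \<Rightarrow> ('a \<Rightarrow> 'b::euclidean_space) \<Rightarrow> real" where
  "L2_norm M f = sqrt (\<integral>x. (norm (f x))\<^sup>2 \<partial>M)"

text \<open>On a finite measure space square integrability implies integrability, so requiring the
  integral of \<open>w\<close> to exist is no restriction.\<close>

definition L2_diamond :: "'a measure \<Rightarrow> ('a \<Rightarrow> real) set" where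
  "L2_diamond M = {w \<in> L2 M. has_bochner_integral M w 0}"

definition Linf_norm :: "'a measure \<Rightarrow> ('a \<Rightarrow> real) \<Rightarrow> real" where
  "Linf_norm M w = real_of_ereal (esssup M (\<lambda>x. ereal \<bar>w x\<bar>))"

definition essinf :: "'a measure \<Rightarrow> ('a \<Rightarrow> real) \<Rightarrow> ereal" where
  "essinf M w = - esssup M (\<lambda>x. - ereal (w x))"

definition Linf :: "'a measure \<Rightarrow> ('a \<Rightarrow> real) set" where
  "Linf M = {w \<in> borel_measurable M. esssup M (\<lambda>x. ereal \<bar>w x\<bar>) < \<infinity>}"

definition Linf_plus :: "'a::euclidean_space set \<Rightarrow> ('a \<Rightarrow> real) set" where
  "Linf_plus \<Omega> = {w \<in> Linf (lebesgue_on \<Omega>). 0 < essinf (lebesgue_on \<Omega>) w}"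

section \<open>Operators on mean-free square-integrable functions\<close>

definition bounded_op :: "'a measure \<Rightarrow> (('a \<Rightarrow> real) \<Rightarrow> 'a \<Rightarrow> real) \<Rightarrow> bool" where
  "bounded_op M S \<longleftrightarrow>
     (\<forall>f\<in>L2_diamond M. S f \<in> L2_diamond M) \<and>
     (\<forall>f\<in>L2_diamond M. \<forall>g\<in>L2_diamond M. \<forall>a b.
        AE x in M. S (\<lambda>y. a * f y + b * g y) x = a * S f x + b * S g x) \<and>
     (\<exists>C. \<forall>f\<in>L2_diamond M. L2_norm M (S f) \<le> C * L2_norm M f)"

definition op_norm :: "'a measure \<Rightarrow> (('a \<Rightarrow> real) \<Rightarrow> 'a \<Rightarrow> real) \<Rightarrow> real" where
  "op_norm M S = (SUP f\<in>{f \<in> L2_diamond M. L2_norm M f \<le> 1}. L2_norm M (S f))"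

definition compact_op :: "'a measure \<Rightarrow> (('a \<Rightarrow> real) \<Rightarrow> 'a \<Rightarrow> real) \<Rightarrow> bool" where
  "compact_op M S \<longleftrightarrow> bounded_op M S \<and>
     (\<forall>F :: nat \<Rightarrow> 'a \<Rightarrow> real. (\<forall>k. F k \<in> L2_diamond M \<and> L2_norm M (F k) \<le> 1) \<longrightarrow>
        (\<exists>g\<in>L2_diamond M. \<exists>r. strict_mono r \<and>
           (\<lambda>k. L2_norm M (\<lambda>x. S (F (r k)) x - g x)) \<longlonglongrightarrow> 0))"

definition self_adjoint :: "'a measure \<Rightarrow> (('a \<Rightarrow> real) \<Rightarrow> 'a \<Rightarrow> real) \<Rightarrow> bool" where
  "self_adjoint M S \<longleftrightarrow>
     (\<forall>f\<in>L2_diamond M. \<forall>g\<in>L2_diamond M. L2_inner M (S f) g = L2_inner M f (S g))"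

definition pos_semidef :: "'a measure \<Rightarrow> (('a \<Rightarrow> real) \<Rightarrow> 'a \<Rightarrow> real) \<Rightarrow> bool" where
  "pos_semidef M S \<longleftrightarrow> (\<forall>f\<in>L2_diamond M. 0 \<le> L2_inner M (S f) f)"

text \<open>The real spectrum: all \<open>s\<close> such that \<open>S - s Id\<close> has no bounded two-sided inverse. For
  self-adjoint operators this is the whole spectrum.\<close>

definition spectrum :: "'a measure \<Rightarrow> (('a \<Rightarrow> real) \<Rightarrow> 'a \<Rightarrow> real) \<Rightarrow> real set" where
  "spectrum M S = {s. \<not> (\<exists>R. bounded_op M R \<and>
     (\<forall>f\<in>L2_diamond M.
        (AE x in M. R (\<lambda>y. S f y - s * f y) x = f x) \<and>
        (AE x in M. S (R f) x - s * R f x = f x)))}"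

section \<open>Smooth functions and the first-order Sobolev space\<close>

text \<open>In the next two definitions \<open>D [b\<^sub>1, \<dots>, b\<^sub>m]\<close> is the iterated partial derivative of \<open>f\<close> in the
  coordinate directions \<open>b\<^sub>m, \<dots>, b\<^sub>1\<close>.\<close>

definition smooth_derivs ::
    "'a::euclidean_space set \<Rightarrow> ('a \<Rightarrow> real) \<Rightarrow> ('a list \<Rightarrow> 'a \<Rightarrow> real) \<Rightarrow> bool" where
  "smooth_derivs U f D \<longleftrightarrow> (\<forall>x\<in>U. D [] x = f x) \<and>
     (\<forall>bs\<in>lists Basis. \<forall>x\<in>U. (D bs has_derivative (\<lambda>v. \<Sum>b\<in>Basis. (v \<bullet> b) * D (b # bs) x)) (at x))"

text \<open>For a bounded open set, uniform continuity of a derivative is the same as having a continuous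
  extension to the closure.\<close>

definition smooth_on_closure :: "'a::euclidean_space set \<Rightarrow> ('a \<Rightarrow> real) \<Rightarrow> bool" where
  "smooth_on_closure \<Omega> f \<longleftrightarrow>
     (\<exists>D. smooth_derivs \<Omega> f D \<and> (\<forall>bs\<in>lists Basis. uniformly_continuous_on \<Omega> (D bs)))"

definition smooth :: "('a::euclidean_space \<Rightarrow> real) \<Rightarrow> bool" where
  "smooth f \<longleftrightarrow> (\<exists>D. smooth_derivs UNIV f D)"

definition test_function :: "'a::euclidean_space set \<Rightarrow> ('a \<Rightarrow> real) \<Rightarrow> bool" where
  "test_function \<Omega> \<phi> \<longleftrightarrow>
     smooth \<phi> \<and> compact (closure {x. \<phi> x \<noteq> 0}) \<and> closure {x. \<phi> x \<noteq> 0} \<subseteq> \<Omega>"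

definition has_weak_gradient :: "'a::euclidean_space set \<Rightarrow> ('a \<Rightarrow> real) \<Rightarrow> ('a \<Rightarrow> 'a) \<Rightarrow> bool" where
  "has_weak_gradient \<Omega> u G \<longleftrightarrow>
     (\<forall>\<phi> d\<phi>. test_function \<Omega> \<phi> \<and> (\<forall>x. GDERIV \<phi> x :> d\<phi> x) \<longrightarrow>
        (\<integral>x. u x *\<^sub>R d\<phi> x \<partial>lebesgue_on \<Omega>) = - (\<integral>x. \<phi> x *\<^sub>R G x \<partial>lebesgue_on \<Omega>))"

definition H1 :: "'a::euclidean_space set \<Rightarrow> ('a \<Rightarrow> real) set" where
  "H1 \<Omega> = {u \<in> L2 (lebesgue_on \<Omega>). \<exists>G\<in>L2 (lebesgue_on \<Omega>). has_weak_gradient \<Omega> u G}"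

definition weak_gradient :: "'a::euclidean_space set \<Rightarrow> ('a \<Rightarrow> real) \<Rightarrow> 'a \<Rightarrow> 'a" where
  "weak_gradient \<Omega> u = (SOME G. G \<in> L2 (lebesgue_on \<Omega>) \<and> has_weak_gradient \<Omega> u G)"

definition H1_norm :: "'a::euclidean_space set \<Rightarrow> ('a \<Rightarrow> real) \<Rightarrow> real" where
  "H1_norm \<Omega> u =
     sqrt ((L2_norm (lebesgue_on \<Omega>) u)\<^sup>2 + (L2_norm (lebesgue_on \<Omega>) (weak_gradient \<Omega> u))\<^sup>2)"

text \<open>The trace operator is the continuous extension of the restriction to the boundary. Restrictions
  of smooth functions on the whole space are dense in \<open>H1 \<Omega>\<close> for bounded Lipschitz domains.\<close>

definition has_trace :: "'a::euclidean_space set \<Rightarrow> ('a \<Rightarrow> real) \<Rightarrow> ('a \<Rightarrow> real) \<Rightarrow> bool" where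
  "has_trace \<Omega> u g \<longleftrightarrow> g \<in> L2 (surface \<Omega>) \<and>
     (\<exists>\<phi> :: nat \<Rightarrow> 'a \<Rightarrow> real. (\<forall>k. smooth (\<phi> k)) \<and>
        (\<lambda>k. H1_norm \<Omega> (\<lambda>x. \<phi> k x - u x)) \<longlonglongrightarrow> 0 \<and>
        (\<lambda>k. L2_norm (surface \<Omega>) (\<lambda>x. \<phi> k x - g x)) \<longlonglongrightarrow> 0)"

definition trace :: "'a::euclidean_space set \<Rightarrow> ('a \<Rightarrow> real) \<Rightarrow> 'a \<Rightarrow> real" where
  "trace \<Omega> u = (SOME g. has_trace \<Omega> u g)"

definition H1_diamond :: "'a::euclidean_space set \<Rightarrow> ('a \<Rightarrow> real) set" where
  "H1_diamond \<Omega> = {u \<in> H1 \<Omega>. has_bochner_integral (surface \<Omega>) (trace \<Omega> u) 0}"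

section \<open>The Neumann-to-Dirichlet map\<close>

definition weak_neumann_solution ::
    "'a::euclidean_space set \<Rightarrow> ('a \<Rightarrow> real) \<Rightarrow> ('a \<Rightarrow> real) \<Rightarrow> ('a \<Rightarrow> real) \<Rightarrow> bool" where
  "weak_neumann_solution \<Omega> \<gamma> f u \<longleftrightarrow> u \<in> H1 \<Omega> \<and>
     (\<forall>v\<in>H1 \<Omega>. (\<integral>x. \<gamma> x * (weak_gradient \<Omega> u x \<bullet> weak_gradient \<Omega> v x) \<partial>lebesgue_on \<Omega>)
        = (\<integral>x. f x * trace \<Omega> v x \<partial>surface \<Omega>))"

definition NtD :: "'a::euclidean_space set \<Rightarrow> ('a \<Rightarrow> real) \<Rightarrow> ('a \<Rightarrow> real) \<Rightarrow> 'a \<Rightarrow> real" where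
  "NtD \<Omega> \<gamma> f = trace \<Omega> (SOME u. u \<in> H1_diamond \<Omega> \<and> weak_neumann_solution \<Omega> \<gamma> f u)"

section \<open>The families of balls\<close>

definition psd_balls ::
    "'a::euclidean_space set \<Rightarrow> real \<Rightarrow> ('a set \<Rightarrow> ('a \<Rightarrow> real) \<Rightarrow> 'a \<Rightarrow> real) \<Rightarrow> 'a set set" where
  "psd_balls \<Omega> \<alpha> S = {B. (\<exists>c r. 0 < r \<and> B = ball c r) \<and> B \<subseteq> \<Omega> \<and>
     pos_semidef (surface \<Omega>) (\<lambda>f x. S B f x + \<alpha> * f x)}"

end

(* Both inclusions compare quadratic forms on the unit sphere. For the first one, the optimal lower
   form bound m of a bounded self-adjoint operator S is a spectral value: if S - m had a bounded
   inverse, Cauchy-Schwarz for the semidefinite form of S - m would make S - m coercive, and m could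
   be increased. Hence T_h(B) >= delta - alpha, and the noise costs at most delta. For the second one,
   T(B) differs from the noisy operator by at most delta plus the two model errors, which are bounded
   uniformly in B because the conductivities gamma_0 + beta chi_B are uniformly bounded. *)
theory Submission
  imports Defs
begin

section \<open>The space of mean-free square-integrable functions\<close>

lemma L2_realD:
  fixes f :: "'a \<Rightarrow> real"
  assumes "f \<in> L2 M"
  shows "f \<in> borel_measurable M" "integrable M (\<lambda>x. (f x)\<^sup>2)"
  using assms by (auto simp: L2_def)

text \<open>The product is dominated by \<open>(f x)\<^sup>2 + (g x)\<^sup>2\<close>. Since the
  integral of a non-integrable function defaults to 0, \<open>L2_inner\<close> is bilinear only
  where such integrability is known.\<close>

lemma L2_mult_integrable:
  fixes f g :: "'a \<Rightarrow> real"
  assumes f: "f \<in> L2 M" and g: "g \<in> L2 M"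
  shows "integrable M (\<lambda>x. f x * g x)"
proof (rule Bochner_Integration.integrable_bound)
  show "integrable M (\<lambda>x. (f x)\<^sup>2 + (g x)\<^sup>2)"
    using L2_realD[OF f] L2_realD[OF g] by auto
  show "(\<lambda>x. f x * g x) \<in> borel_measurable M"
    using L2_realD(1)[OF f] L2_realD(1)[OF g] by auto
  have "\<bar>a * b\<bar> \<le> a\<^sup>2 + b\<^sup>2" for a b :: real
  proof -
    have "2 * (\<bar>a\<bar> * \<bar>b\<bar>) \<le> a\<^sup>2 + b\<^sup>2"
      using sum_squares_bound[of "\<bar>a\<bar>" "\<bar>b\<bar>"] by (simp add: mult.assoc)
    moreover have "0 \<le> \<bar>a\<bar> * \<bar>b\<bar>" by (rule mult_nonneg_nonneg) simp_all
    ultimately show ?thesis unfolding abs_mult by linarith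
  qed
  then show "AE x in M. norm (f x * g x) \<le> norm ((f x)\<^sup>2 + (g x)\<^sup>2)"
    by simp
qed

lemma L2_lincomb:
  fixes f g :: "'a \<Rightarrow> real"
  assumes f: "f \<in> L2 M" and g: "g \<in> L2 M"
  shows "(\<lambda>x. a * f x + b * g x) \<in> L2 M"
proof -
  have "integrable M (\<lambda>x. a\<^sup>2 * (f x)\<^sup>2 + b\<^sup>2 * (g x)\<^sup>2 + 2 * a * b * (f x * g x))"
    using L2_realD[OF f] L2_realD[OF g] L2_mult_integrable[OF f g] by auto
  then have "integrable M (\<lambda>x. (a * f x + b * g x)\<^sup>2)"
    by (simp add: power2_eq_square algebra_simps)
  then show ?thesis
    using L2_realD(1)[OF f] L2_realD(1)[OF g] by (auto simp: L2_def)
qed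

lemma L2_diamond_L2: "f \<in> L2_diamond M \<Longrightarrow> f \<in> L2 M"
  by (simp add: L2_diamond_def)

lemma L2_diamond_lincomb:
  assumes f: "f \<in> L2_diamond M" and g: "g \<in> L2_diamond M"
  shows "(\<lambda>x. a * f x + b * g x) \<in> L2_diamond M"
proof -
  have "has_bochner_integral M f 0" "has_bochner_integral M g 0"
    using assms by (auto simp: L2_diamond_def)
  then have "has_bochner_integral M (\<lambda>x. a * f x + b * g x) (a * 0 + b * 0)"
    by (intro has_bochner_integral_add has_bochner_integral_mult_right)
  then show ?thesis
    using L2_lincomb[of f M g a b] assms by (auto simp: L2_diamond_def)
qed

lemma L2_inner_commute:
  fixes f g :: "'a \<Rightarrow> real"
  shows "L2_inner M f g = L2_inner M g f"
  by (simp add: L2_inner_def mult.commute)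

lemma L2_inner_lincomb_left:
  fixes f g k :: "'a \<Rightarrow> real"
  assumes "f \<in> L2 M" "g \<in> L2 M" "k \<in> L2 M"
  shows "L2_inner M (\<lambda>x. a * f x + b * g x) k = a * L2_inner M f k + b * L2_inner M g k"
proof -
  have "L2_inner M (\<lambda>x. a * f x + b * g x) k = (\<integral>x. a * (f x * k x) + b * (g x * k x) \<partial>M)"
    by (simp add: L2_inner_def algebra_simps)
  also have "\<dots> = a * (\<integral>x. f x * k x \<partial>M) + b * (\<integral>x. g x * k x \<partial>M)"
    using L2_mult_integrable[of f M k] L2_mult_integrable[of g M k] assms by simp
  finally show ?thesis by (simp add: L2_inner_def)
qed

lemma L2_inner_lincomb_right:
  fixes f g k :: "'a \<Rightarrow> real"
  assumes "f \<in> L2 M" "g \<in> L2 M" "k \<in> L2 M"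
  shows "L2_inner M k (\<lambda>x. a * f x + b * g x) = a * L2_inner M k f + b * L2_inner M k g"
  using L2_inner_lincomb_left[OF assms, of a b] by (simp add: L2_inner_commute)

text \<open>Operators act linearly only up to null sets; this lets their linearity be used inside
  quadratic forms.\<close>

lemma L2_inner_cong_AE:
  fixes f f' g :: "'a \<Rightarrow> real"
  assumes "f \<in> L2 M" "f' \<in> L2 M" "g \<in> L2 M" "AE x in M. f x = f' x"
  shows "L2_inner M f g = L2_inner M f' g"
  unfolding L2_inner_def
proof (rule integral_cong_AE)
  show "AE x in M. f x \<bullet> g x = f' x \<bullet> g x" using assms(4) by eventually_elim simp
qed (use assms(1-3)[THEN L2_realD(1)] in auto)

lemma L2_inner_self: "L2_inner M f f = (L2_norm M f)\<^sup>2" for f :: "'a \<Rightarrow> real"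
  by (simp add: L2_inner_def L2_norm_def power2_eq_square)

lemma L2_norm_nonneg: "0 \<le> L2_norm M f"
  by (simp add: L2_norm_def)

lemma L2_norm_cmult: "L2_norm M (\<lambda>x. a * f x) = \<bar>a\<bar> * L2_norm M f" for f :: "'a \<Rightarrow> real"
  by (simp add: L2_norm_def abs_mult power_mult_distrib real_sqrt_mult)

lemma L2_norm_cong_AE:
  fixes f g :: "'a \<Rightarrow> real"
  assumes "f \<in> L2 M" "g \<in> L2 M" "AE x in M. f x = g x"
  shows "L2_norm M f = L2_norm M g"
proof -
  have "(\<integral>x. (norm (f x))\<^sup>2 \<partial>M) = (\<integral>x. (norm (g x))\<^sup>2 \<partial>M)"
  proof (rule integral_cong_AE)
    show "AE x in M. (norm (f x))\<^sup>2 = (norm (g x))\<^sup>2" using assms(3) by eventually_elim simp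
  qed (use assms(1,2)[THEN L2_realD(1)] in auto)
  then show ?thesis by (simp add: L2_norm_def)
qed

section \<open>Quadratic forms of bounded operators\<close>

lemma bounded_opD:
  assumes "bounded_op M S" "f \<in> L2_diamond M"
  shows "S f \<in> L2_diamond M"
    and "g \<in> L2_diamond M \<Longrightarrow>
      AE x in M. S (\<lambda>y. a * f y + b * g y) x = a * S f x + b * S g x"
  using assms by (auto simp: bounded_op_def)

text \<open>The constant in \<open>bounded_op\<close> may have any sign; passing to \<bar>C\<bar> +
  1 makes it positive, so that it can be divided by later.\<close>

lemma bounded_op_bound:
  assumes "bounded_op M S"
  obtains C where "C > 0" "\<And>f. f \<in> L2_diamond M \<Longrightarrow> L2_norm M (S f) \<le> C * L2_norm M f"
proof -
  obtain C where C: "\<And>f. f \<in> L2_diamond M \<Longrightarrow> L2_norm M (S f) \<le> C * L2_norm M f"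
    using assms unfolding bounded_op_def by blast
  have "C * L2_norm M f \<le> (\<bar>C\<bar> + 1) * L2_norm M f" for f
    by (intro mult_right_mono L2_norm_nonneg) auto
  with C show ?thesis
    by (intro that[of "\<bar>C\<bar> + 1"]) (auto intro: order_trans)
qed

lemma bounded_op_id: "bounded_op M (\<lambda>f. f)"
  unfolding bounded_op_def by (auto intro!: exI[of _ 1])

section \<open>Cauchy-Schwarz for semidefinite forms\<close>

lemma quadratic_nonneg_discriminant:
  fixes a b c :: real
  assumes "0 \<le> c" "\<And>t. 0 \<le> a + 2 * b * t + c * t\<^sup>2"
  shows "b\<^sup>2 \<le> a * c"
proof (cases "c = 0")
  case True
  have "b = 0"
  proof (rule ccontr)
    assume "b \<noteq> 0"
    \<comment> \<open>At this t the affine function a + 2bt takes the value -1.\<close>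
    then show False using assms(2)[of "- (a + 1) / (2 * b)"] True by simp
  qed
  with True show ?thesis by simp
next
  case False
  with assms(1) have "c > 0" by simp
  \<comment> \<open>The point -b/c minimises the polynomial.\<close>
  have "0 \<le> a + 2 * b * (- b / c) + c * (- b / c)\<^sup>2" by (rule assms(2))
  also have "\<dots> = a - b\<^sup>2 / c" using False by (simp add: power2_eq_square field_simps)
  finally show ?thesis using \<open>c > 0\<close> by (simp add: field_simps)
qed

text \<open>The form of S at f + t g is a quadratic polynomial in t that is never negative, so its
  discriminant is not positive. The form may degenerate, which is what the optimal shift of an
  operator requires.\<close>

lemma pos_semidef_Cauchy_Schwarz:
  assumes S: "bounded_op M S" "self_adjoint M S" "pos_semidef M S"
    and f: "f \<in> L2_diamond M" and g: "g \<in> L2_diamond M"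
  shows "(L2_inner M (S f) g)\<^sup>2 \<le> L2_inner M (S f) f * L2_inner M (S g) g"
proof (rule quadratic_nonneg_discriminant)
  show "0 \<le> L2_inner M (S g) g" using S(3) g by (simp add: pos_semidef_def)
  fix t :: real
  \<comment> \<open>The factor 1 keeps \<open>k\<close> in the two-term shape of the linearity
    lemmas.\<close>
  define k where "k = (\<lambda>x. 1 * f x + t * g x)"
  have k: "k \<in> L2_diamond M"
    unfolding k_def by (rule L2_diamond_lincomb[OF f g])
  note mem = f g k bounded_opD(1)[OF S(1) f] bounded_opD(1)[OF S(1) g] bounded_opD(1)[OF S(1) k]
  note L2 = mem[THEN L2_diamond_L2]
  have sym: "L2_inner M (S g) f = L2_inner M (S f) g"
    using S(2) f g by (metis self_adjoint_def L2_inner_commute)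
  have "L2_inner M (S k) k = L2_inner M (\<lambda>x. 1 * S f x + t * S g x) k"
  proof (rule L2_inner_cong_AE[OF L2(6) _ L2(3)])
    show "AE x in M. S k x = 1 * S f x + t * S g x"
      unfolding k_def by (rule bounded_opD(2)[OF S(1) f g])
  qed (rule L2_lincomb[OF L2(4,5)])
  also have "\<dots> = L2_inner M (S f) k + t * L2_inner M (S g) k"
    by (subst L2_inner_lincomb_left[OF L2(4,5,3)]) simp
  also have "\<dots> = L2_inner M (S f) f + t * L2_inner M (S f) g
      + t * (L2_inner M (S g) f + t * L2_inner M (S g) g)"
    using L2_inner_lincomb_right[OF L2(1,2,4), of 1 t] L2_inner_lincomb_right[OF L2(1,2,5), of 1 t]
    by (simp add: k_def)
  also have "\<dots> = L2_inner M (S f) f + 2 * L2_inner M (S f) g * t + L2_inner M (S g) g * t\<^sup>2"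
    by (simp add: sym power2_eq_square algebra_simps)
  finally show "0 \<le> L2_inner M (S f) f + 2 * L2_inner M (S f) g * t + L2_inner M (S g) g * t\<^sup>2"
    using S(3) k unfolding pos_semidef_def by metis
qed

text \<open>The ordinary Cauchy-Schwarz inequality is the case of the identity operator.\<close>

lemma L2_inner_abs_le:
  assumes f: "f \<in> L2_diamond M" and g: "g \<in> L2_diamond M"
  shows "\<bar>L2_inner M f g\<bar> \<le> L2_norm M f * L2_norm M g"
proof -
  have "(L2_inner M f g)\<^sup>2 \<le> L2_inner M f f * L2_inner M g g"
    by (rule pos_semidef_Cauchy_Schwarz[OF bounded_op_id _ _ f g])
      (auto simp: self_adjoint_def pos_semidef_def L2_inner_self)
  then have "(L2_inner M f g)\<^sup>2 \<le> (L2_norm M f * L2_norm M g)\<^sup>2"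
    by (simp add: L2_inner_self power_mult_distrib)
  then show ?thesis
    using L2_norm_nonneg[of M f] L2_norm_nonneg[of M g] by (simp add: abs_le_square_iff[symmetric])
qed

lemma L2_norm_lincomb_le:
  assumes f: "f \<in> L2_diamond M" and g: "g \<in> L2_diamond M"
  shows "L2_norm M (\<lambda>x. a * f x + b * g x) \<le> \<bar>a\<bar> * L2_norm M f + \<bar>b\<bar> * L2_norm M g"
proof -
  note L2 = f[THEN L2_diamond_L2] g[THEN L2_diamond_L2] L2_diamond_lincomb[OF f g, THEN L2_diamond_L2]
  have "(L2_norm M (\<lambda>x. a * f x + b * g x))\<^sup>2
      = L2_inner M (\<lambda>x. a * f x + b * g x) (\<lambda>x. a * f x + b * g x)"
    by (simp add: L2_inner_self)
  also have "\<dots> = a\<^sup>2 * (L2_norm M f)\<^sup>2 + b\<^sup>2 * (L2_norm M g)\<^sup>2 + 2 * (a * b * L2_inner M f g)"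
    unfolding L2_inner_lincomb_left[OF L2] L2_inner_lincomb_right[OF L2(1,2) L2(1)]
      L2_inner_lincomb_right[OF L2(1,2) L2(2)] L2_inner_commute[of M g f]
    by (simp add: L2_inner_self power2_eq_square algebra_simps)
  also have "a * b * L2_inner M f g \<le> \<bar>a\<bar> * \<bar>b\<bar> * (L2_norm M f * L2_norm M g)"
  proof -
    have "a * b * L2_inner M f g \<le> \<bar>a * b\<bar> * \<bar>L2_inner M f g\<bar>"
      by (metis abs_ge_self abs_mult)
    also have "\<dots> \<le> \<bar>a * b\<bar> * (L2_norm M f * L2_norm M g)"
      by (intro mult_left_mono L2_inner_abs_le f g) auto
    finally show ?thesis by (simp add: abs_mult)
  qed
  also have "a\<^sup>2 * (L2_norm M f)\<^sup>2 + b\<^sup>2 * (L2_norm M g)\<^sup>2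
      + 2 * (\<bar>a\<bar> * \<bar>b\<bar> * (L2_norm M f * L2_norm M g)) = (\<bar>a\<bar> * L2_norm M f + \<bar>b\<bar> * L2_norm M g)\<^sup>2"
    by (simp add: power2_sum power_mult_distrib)
  finally show ?thesis
    by (rule power2_le_imp_le) (simp_all add: L2_norm_nonneg)
qed

section \<open>Linear combinations and norms of operators\<close>

lemma bounded_op_lincomb:
  assumes S: "bounded_op M S" and T: "bounded_op M T"
  shows "bounded_op M (\<lambda>f x. a * S f x + b * T f x)"
  unfolding bounded_op_def
proof (intro conjI ballI allI)
  fix f assume f: "f \<in> L2_diamond M"
  show "(\<lambda>x. a * S f x + b * T f x) \<in> L2_diamond M"
    by (intro L2_diamond_lincomb bounded_opD(1)[OF S f] bounded_opD(1)[OF T f])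
  fix g c d assume g: "g \<in> L2_diamond M"
  show "AE x in M. a * S (\<lambda>y. c * f y + d * g y) x + b * T (\<lambda>y. c * f y + d * g y) x
      = c * (a * S f x + b * T f x) + d * (a * S g x + b * T g x)"
    using bounded_opD(2)[OF S f g, of c d] bounded_opD(2)[OF T f g, of c d]
    by eventually_elim (simp add: algebra_simps)
next
  obtain C where C: "\<And>f. f \<in> L2_diamond M \<Longrightarrow> L2_norm M (S f) \<le> C * L2_norm M f"
    by (rule bounded_op_bound[OF S]) blast
  obtain D where D: "\<And>f. f \<in> L2_diamond M \<Longrightarrow> L2_norm M (T f) \<le> D * L2_norm M f"
    by (rule bounded_op_bound[OF T]) blast
  show "\<exists>C. \<forall>f\<in>L2_diamond M. L2_norm M (\<lambda>x. a * S f x + b * T f x) \<le> C * L2_norm M f"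
  proof (intro exI ballI)
    fix f assume f: "f \<in> L2_diamond M"
    have "L2_norm M (\<lambda>x. a * S f x + b * T f x) \<le> \<bar>a\<bar> * L2_norm M (S f) + \<bar>b\<bar> * L2_norm M (T f)"
      by (intro L2_norm_lincomb_le bounded_opD(1)[OF S f] bounded_opD(1)[OF T f])
    also have "\<dots> \<le> \<bar>a\<bar> * (C * L2_norm M f) + \<bar>b\<bar> * (D * L2_norm M f)"
      by (intro add_mono mult_left_mono C D f) auto
    finally show "L2_norm M (\<lambda>x. a * S f x + b * T f x) \<le> (\<bar>a\<bar> * C + \<bar>b\<bar> * D) * L2_norm M f"
      by (simp add: algebra_simps)
  qed
qed

lemma bounded_op_diff:
  assumes "bounded_op M S" "bounded_op M T"
  shows "bounded_op M (\<lambda>f x. S f x - T f x)"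
  using bounded_op_lincomb[OF assms, of 1 "-1"] by simp

lemma self_adjoint_lincomb:
  assumes "bounded_op M S" "self_adjoint M S" "bounded_op M T" "self_adjoint M T"
  shows "self_adjoint M (\<lambda>f x. a * S f x + b * T f x)"
  unfolding self_adjoint_def
proof (intro ballI)
  fix f g assume f: "f \<in> L2_diamond M" and g: "g \<in> L2_diamond M"
  note L2 = f[THEN L2_diamond_L2] g[THEN L2_diamond_L2]
    bounded_opD(1)[OF assms(1) f, THEN L2_diamond_L2] bounded_opD(1)[OF assms(3) f, THEN L2_diamond_L2]
    bounded_opD(1)[OF assms(1) g, THEN L2_diamond_L2] bounded_opD(1)[OF assms(3) g, THEN L2_diamond_L2]
  show "L2_inner M (\<lambda>x. a * S f x + b * T f x) g = L2_inner M f (\<lambda>x. a * S g x + b * T g x)"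
    using assms(2,4) f g
    by (simp add: L2_inner_lincomb_left[OF L2(3,4,2)] L2_inner_lincomb_right[OF L2(5,6,1)]
        self_adjoint_def)
qed

text \<open>The supremum in \<open>op_norm\<close> sees only the unit ball, so f is normalised
  first. If f has norm zero, boundedness of S already forces S f to have norm zero.\<close>

lemma op_norm_bound:
  assumes S: "bounded_op M S" and f: "f \<in> L2_diamond M"
  shows "L2_norm M (S f) \<le> op_norm M S * L2_norm M f"
proof (cases "L2_norm M f = 0")
  case True
  obtain C where "\<And>f. f \<in> L2_diamond M \<Longrightarrow> L2_norm M (S f) \<le> C * L2_norm M f"
    by (rule bounded_op_bound[OF S]) blast
  from this[OF f] True show ?thesis by simp
next
  case False
  define n where "n = L2_norm M f"
  have n: "n > 0" using False L2_norm_nonneg[of M f] by (simp add: n_def)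
  \<comment> \<open>The zero summand puts a plain scaling into the two-term form of the linearity
    lemmas.\<close>
  define g where "g = (\<lambda>x. (1 / n) * f x + 0 * f x)"
  have g: "g \<in> L2_diamond M" unfolding g_def by (intro L2_diamond_lincomb f)
  have gn: "L2_norm M g = 1"
    using n L2_norm_cmult[of M "1 / n" f] by (simp add: g_def n_def[symmetric])
  obtain C where C: "C > 0" "\<And>f. f \<in> L2_diamond M \<Longrightarrow> L2_norm M (S f) \<le> C * L2_norm M f"
    by (rule bounded_op_bound[OF S]) blast
  \<comment> \<open>A real supremum is an upper bound only if the set is bounded above.\<close>
  have "bdd_above ((\<lambda>f. L2_norm M (S f)) ` {f \<in> L2_diamond M. L2_norm M f \<le> 1})"
  proof (rule bdd_aboveI2)
    fix k assume "k \<in> {f \<in> L2_diamond M. L2_norm M f \<le> 1}"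
    then show "L2_norm M (S k) \<le> C"
      using C(2)[of k] mult_left_mono[of "L2_norm M k" 1 C] C(1) by (auto intro: order_trans)
  qed
  then have "L2_norm M (S g) \<le> op_norm M S"
    unfolding op_norm_def using g gn by (intro cSUP_upper) auto
  moreover have "L2_norm M (S g) = L2_norm M (\<lambda>x. (1 / n) * S f x + 0 * S f x)"
  proof (rule L2_norm_cong_AE)
    show "AE x in M. S g x = (1 / n) * S f x + 0 * S f x"
      unfolding g_def by (rule bounded_opD(2)[OF S f f])
  qed (intro L2_diamond_L2 bounded_opD(1)[OF S] L2_diamond_lincomb f g)+
  moreover have "\<dots> = L2_norm M (S f) / n"
    using n L2_norm_cmult[of M "1 / n" "S f"] by simp
  ultimately show ?thesis using n by (simp add: n_def field_simps)
qed

text \<open>This turns operator norm estimates for the noise and the model errors into form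
  estimates.\<close>

lemma L2_inner_op_abs_le:
  assumes "bounded_op M S" "op_norm M S \<le> C" "f \<in> L2_diamond M"
  shows "\<bar>L2_inner M (S f) f\<bar> \<le> C * (L2_norm M f)\<^sup>2"
proof -
  have "\<bar>L2_inner M (S f) f\<bar> \<le> L2_norm M (S f) * L2_norm M f"
    by (intro L2_inner_abs_le bounded_opD(1)[OF assms(1,3)] assms(3))
  also have "\<dots> \<le> op_norm M S * L2_norm M f * L2_norm M f"
    by (intro mult_right_mono op_norm_bound assms L2_norm_nonneg)
  also have "\<dots> \<le> C * L2_norm M f * L2_norm M f"
    by (intro mult_right_mono assms L2_norm_nonneg)
  finally show ?thesis by (simp add: power2_eq_square mult.assoc)
qed

section \<open>Lower form bounds and the spectrum\<close>

text \<open>Put q = (S f, f) and p = (S f, S f). Cauchy-Schwarz for the form of S at f and S f gives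
  p^2 <= q (S S f, S f) <= q C p, hence p <= C q. The inverse R, with bound K, gives (f, f) <= K^2
  p, so (f, f) <= K^2 C q.\<close>

lemma pos_semidef_invertible_coercive:
  assumes S: "bounded_op M S" "self_adjoint M S" "pos_semidef M S"
    and R: "bounded_op M R" "\<And>f. f \<in> L2_diamond M \<Longrightarrow> AE x in M. R (S f) x = f x"
  obtains e where "e > 0" "\<And>f. f \<in> L2_diamond M \<Longrightarrow> e * (L2_norm M f)\<^sup>2 \<le> L2_inner M (S f) f"
proof -
  obtain C where C: "C > 0" "\<And>f. f \<in> L2_diamond M \<Longrightarrow> L2_norm M (S f) \<le> C * L2_norm M f"
    by (rule bounded_op_bound[OF S(1)]) blast
  obtain K where K: "K > 0" "\<And>f. f \<in> L2_diamond M \<Longrightarrow> L2_norm M (R f) \<le> K * L2_norm M f"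
    by (rule bounded_op_bound[OF R(1)]) blast
  show ?thesis
  proof (rule that[of "1 / (K\<^sup>2 * C)"])
    show "0 < 1 / (K\<^sup>2 * C)" using C(1) K(1) by simp
    fix f assume f: "f \<in> L2_diamond M"
    define q where "q = L2_inner M (S f) f"
    define p where "p = (L2_norm M (S f))\<^sup>2"
    have q: "q \<ge> 0" using S(3) f by (simp add: q_def pos_semidef_def)
    note Sf = bounded_opD(1)[OF S(1) f]
    have "p\<^sup>2 \<le> q * L2_inner M (S (S f)) (S f)"
      using pos_semidef_Cauchy_Schwarz[OF S f Sf] by (simp add: L2_inner_self p_def q_def)
    also have "L2_inner M (S (S f)) (S f) \<le> C * p"
    proof -
      have "L2_inner M (S (S f)) (S f) \<le> L2_norm M (S (S f)) * L2_norm M (S f)"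
        using L2_inner_abs_le[OF bounded_opD(1)[OF S(1) Sf] Sf] by simp
      also have "\<dots> \<le> C * L2_norm M (S f) * L2_norm M (S f)"
        by (intro mult_right_mono C Sf L2_norm_nonneg)
      finally show ?thesis by (simp add: p_def power2_eq_square mult.assoc)
    qed
    finally have "p\<^sup>2 \<le> q * (C * p)" using q by (simp add: mult_left_mono)
    then have "p * p \<le> q * C * p" by (simp add: power2_eq_square mult.assoc)
    moreover have "0 \<le> p" "0 \<le> q * C" using q C(1) by (simp_all add: p_def)
    \<comment> \<open>For p = 0 the claim is nonnegativity of q C; otherwise p is cancelled.\<close>
    ultimately have pq: "p \<le> q * C" by (cases "p = 0") (auto simp: mult_le_cancel_right)
    have "L2_norm M f = L2_norm M (R (S f))"
      using R(2)[OF f]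
      by (intro L2_norm_cong_AE L2_diamond_L2 f bounded_opD(1)[OF R(1)] Sf) auto
    also have "\<dots> \<le> K * L2_norm M (S f)" by (rule K(2)[OF Sf])
    finally have "(L2_norm M f)\<^sup>2 \<le> (K * L2_norm M (S f))\<^sup>2"
      by (intro power_mono L2_norm_nonneg)
    also have "\<dots> = K\<^sup>2 * p" by (simp add: p_def power_mult_distrib)
    also have "\<dots> \<le> K\<^sup>2 * (q * C)" by (intro mult_left_mono pq) auto
    finally show "1 / (K\<^sup>2 * C) * (L2_norm M f)\<^sup>2 \<le> L2_inner M (S f) f"
      using C(1) K(1) by (simp add: q_def field_simps)
  qed
qed

text \<open>It suffices to exhibit one spectral value that is itself a lower form bound; the optimal
  lower bound \<open>m\<close> is one. This replaces an appeal to the spectral theorem.\<close>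

lemma spectrum_lower_bound_form:
  assumes S: "bounded_op M S" "self_adjoint M S"
    and c: "\<And>s. s \<in> spectrum M S \<Longrightarrow> c \<le> s"
    and f: "f \<in> L2_diamond M"
  shows "c * (L2_norm M f)\<^sup>2 \<le> L2_inner M (S f) f"
proof (cases "L2_norm M f = 0")
  case True
  then have "L2_inner M (S f) f = 0"
    using L2_inner_abs_le[OF bounded_opD(1)[OF S(1) f] f] by simp
  with True show ?thesis by simp
next
  case False
  define A where "A = {t. \<forall>f\<in>L2_diamond M. t * (L2_norm M f)\<^sup>2 \<le> L2_inner M (S f) f}"
  define m where "m = Sup A"
  have upper: "t \<le> L2_inner M (S g) g / (L2_norm M g)\<^sup>2"
    if "t \<in> A" "g \<in> L2_diamond M" "L2_norm M g \<noteq> 0" for t g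
    using that by (simp add: A_def field_simps)
  \<comment> \<open>The Rayleigh quotient of the given f of nonzero norm bounds \<open>A\<close>
    from above, which is why norm zero was treated separately.\<close>
  have bdd: "bdd_above A" using upper[OF _ f False] by (intro bdd_aboveI)
  have "- op_norm M S \<in> A"
    unfolding A_def using L2_inner_op_abs_le[OF S(1) order_refl] by (force simp: abs_le_iff)
  then have ne: "A \<noteq> {}" by auto
  \<comment> \<open>The supremum is attained: each Rayleigh quotient is an upper bound of
    \<open>A\<close>, hence at least \<open>m\<close>.\<close>
  have m: "m * (L2_norm M g)\<^sup>2 \<le> L2_inner M (S g) g" if g: "g \<in> L2_diamond M" for g
  proof (cases "L2_norm M g = 0")
    case True
    then show ?thesis
      using L2_inner_abs_le[OF bounded_opD(1)[OF S(1) g] g] by simp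
  next
    case False
    then have "m \<le> L2_inner M (S g) g / (L2_norm M g)\<^sup>2"
      unfolding m_def using ne upper g by (intro cSup_least) auto
    then show ?thesis using False by (simp add: field_simps)
  qed
  have "m \<in> spectrum M S"
  proof (rule ccontr)
    assume "m \<notin> spectrum M S"
    then obtain R where R: "bounded_op M R"
      "\<And>f. f \<in> L2_diamond M \<Longrightarrow> AE x in M. R (\<lambda>y. S f y - m * f y) x = f x"
      by (auto simp: spectrum_def)
    let ?S = "\<lambda>f x. 1 * S f x + (- m) * f x"
    have form: "L2_inner M (?S g) g = L2_inner M (S g) g - m * (L2_norm M g)\<^sup>2"
      if g: "g \<in> L2_diamond M" for g
      by (subst L2_inner_lincomb_left)
        (auto intro!: L2_diamond_L2 g bounded_opD(1)[OF S(1)] simp: L2_inner_self)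
    obtain e where e: "e > 0"
      "\<And>f. f \<in> L2_diamond M \<Longrightarrow> e * (L2_norm M f)\<^sup>2 \<le> L2_inner M (?S f) f"
    proof (rule pos_semidef_invertible_coercive)
      show "bounded_op M ?S" by (rule bounded_op_lincomb[OF S(1) bounded_op_id])
      show "self_adjoint M ?S"
        by (rule self_adjoint_lincomb[OF S bounded_op_id]) (simp add: self_adjoint_def)
      show "pos_semidef M ?S" using m form by (simp add: pos_semidef_def)
      show "AE x in M. R (?S f) x = f x" if "f \<in> L2_diamond M" for f
        using R(2)[OF that] by simp
    qed (use R(1) in auto)
    \<comment> \<open>Coercivity of S - m with constant e improves the lower bound to m + e,
      contradicting the choice of \<open>m\<close>.\<close>
    have "m + e \<in> A"
      unfolding A_def using e(2) form by (force simp: algebra_simps)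
    then have "m + e \<le> m" unfolding m_def by (intro cSup_upper bdd)
    with e(1) show False by simp
  qed
  then have "c * (L2_norm M f)\<^sup>2 \<le> m * (L2_norm M f)\<^sup>2" by (intro mult_right_mono c) auto
  also have "\<dots> \<le> L2_inner M (S f) f" by (rule m[OF f])
  finally show ?thesis .
qed

section \<open>Essentially bounded coefficients\<close>

lemma Linf_AE_bound:
  assumes "w \<in> Linf M"
  obtains C where "C \<ge> 0" "AE x in M. \<bar>w x\<bar> \<le> C"
proof -
  have w: "w \<in> borel_measurable M" and fin: "esssup M (\<lambda>x. ereal \<bar>w x\<bar>) < \<infinity>"
    using assms by (auto simp: Linf_def)
  have AE: "AE x in M. ereal \<bar>w x\<bar> \<le> esssup M (\<lambda>x. ereal \<bar>w x\<bar>)"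
    by (rule esssup_AE)
  \<comment> \<open>On a null space the essential supremum is minus infinity; any real C then
    serves, and its absolute value is nonnegative.\<close>
  obtain C where C: "esssup M (\<lambda>x. ereal \<bar>w x\<bar>) \<le> ereal C"
    using fin by (cases "esssup M (\<lambda>x. ereal \<bar>w x\<bar>)") auto
  show ?thesis
  proof (rule that[of "\<bar>C\<bar>"])
    show "AE x in M. \<bar>w x\<bar> \<le> \<bar>C\<bar>"
      using AE
    proof eventually_elim
      case (elim x)
      then have "ereal \<bar>w x\<bar> \<le> ereal C" using C by (rule order_trans)
      then show ?case by simp
    qed
  qed simp
qed

lemma Linf_norm_le:
  assumes "w \<in> borel_measurable M" "0 \<le> C" "AE x in M. \<bar>w x\<bar> \<le> C"
  shows "w \<in> Linf M" "Linf_norm M w \<le> C"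
proof -
  have le: "esssup M (\<lambda>x. ereal \<bar>w x\<bar>) \<le> ereal C"
    using assms by (intro esssup_I) auto
  then show "w \<in> Linf M"
    using assms(1) by (auto simp: Linf_def intro: le_less_trans)
  show "Linf_norm M w \<le> C"
    using le assms(2) unfolding Linf_norm_def
    by (cases "esssup M (\<lambda>x. ereal \<bar>w x\<bar>)") auto
qed

lemma Linf_norm_nonneg:
  assumes "w \<in> Linf M"
  shows "0 \<le> Linf_norm M w"
proof (cases "0 \<le> esssup M (\<lambda>x. ereal \<bar>w x\<bar>)")
  case True
  then show ?thesis unfolding Linf_norm_def by (rule real_of_ereal_pos)
next
  case False
  have "AE x in M. ereal \<bar>w x\<bar> \<le> esssup M (\<lambda>x. ereal \<bar>w x\<bar>)"
    by (rule esssup_AE)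
  \<comment> \<open>A negative essential supremum of an absolute value is possible only on a null
    space. There it equals minus infinity, which \<open>real_of_ereal\<close> sends to 0.\<close>
  then have "AE x in M. ereal \<bar>w x\<bar> \<le> - \<infinity>"
  proof eventually_elim
    case (elim x)
    then have "ereal \<bar>w x\<bar> < 0" using False by (simp only: not_le)
    then show ?case by simp
  qed
  then have "esssup M (\<lambda>x. ereal \<bar>w x\<bar>) \<le> - \<infinity>"
    using assms by (intro esssup_I) (auto simp: Linf_def)
  then show ?thesis by (simp add: Linf_norm_def)
qed

lemma essinf_mono_AE:
  assumes "w' \<in> borel_measurable M" "AE x in M. w x \<le> w' x"
  shows "essinf M w \<le> essinf M w'"
proof -
  have "esssup M (\<lambda>x. - ereal (w' x)) \<le> esssup M (\<lambda>x. - ereal (w x))"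
  proof (rule esssup_AE_mono)
    show "(\<lambda>x. - ereal (w' x)) \<in> borel_measurable M"
      using assms(1) by (intro borel_measurable_uminus_ereal borel_measurable_ereal)
    show "AE x in M. - ereal (w' x) \<le> - ereal (w x)"
      using assms(2) by eventually_elim simp
  qed
  then show ?thesis by (simp add: essinf_def)
qed

lemma Linf_plus_AE_nonneg:
  assumes "w \<in> Linf_plus \<Omega>"
  shows "AE x in lebesgue_on \<Omega>. 0 \<le> w x"
proof -
  have "esssup (lebesgue_on \<Omega>) (\<lambda>x. - ereal (w x)) < 0"
    using assms by (auto simp: Linf_plus_def essinf_def ereal_uminus_less_reorder)
  moreover have "AE x in lebesgue_on \<Omega>. - ereal (w x) \<le> esssup (lebesgue_on \<Omega>) (\<lambda>x. - ereal (w x))"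
    by (rule esssup_AE)
  ultimately show ?thesis
    by (auto elim!: eventually_mono dest: le_less_trans)
qed

text \<open>A nonnegative bounded perturbation cannot lower the essential infimum, so the
  conductivity stays admissible. The norm bound depends on the perturbation only through K.\<close>

lemma Linf_plus_add_nonneg:
  assumes w: "w \<in> Linf_plus \<Omega>" "AE x in lebesgue_on \<Omega>. \<bar>w x\<bar> \<le> C"
    and v: "v \<in> borel_measurable (lebesgue_on \<Omega>)" "AE x in lebesgue_on \<Omega>. 0 \<le> v x \<and> v x \<le> K"
    and nonneg: "0 \<le> C" "0 \<le> K"
  shows "(\<lambda>x. w x + v x) \<in> Linf_plus \<Omega>" "Linf_norm (lebesgue_on \<Omega>) (\<lambda>x. w x + v x) \<le> C + K"
proof -
  have "w \<in> borel_measurable (lebesgue_on \<Omega>)"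
    using w(1) by (auto simp: Linf_plus_def Linf_def)
  with v(1) have meas: "(\<lambda>x. w x + v x) \<in> borel_measurable (lebesgue_on \<Omega>)" by auto
  have AE: "AE x in lebesgue_on \<Omega>. \<bar>w x + v x\<bar> \<le> C + K"
    using w(2) v(2) by eventually_elim auto
  have CK: "0 \<le> C + K" using nonneg by simp
  show "Linf_norm (lebesgue_on \<Omega>) (\<lambda>x. w x + v x) \<le> C + K"
    by (rule Linf_norm_le(2)[OF meas CK AE])
  have "essinf (lebesgue_on \<Omega>) w \<le> essinf (lebesgue_on \<Omega>) (\<lambda>x. w x + v x)"
    using v(2) by (intro essinf_mono_AE meas) (auto elim: eventually_mono)
  then show "(\<lambda>x. w x + v x) \<in> Linf_plus \<Omega>"
    using w(1) Linf_norm_le(1)[OF meas CK AE] by (auto simp: Linf_plus_def intro: less_le_trans)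
qed

lemma indicator_borel_measurable_lebesgue_on:
  assumes "open (U :: 'a::euclidean_space set)"
  shows "(indicator U :: 'a \<Rightarrow> real) \<in> borel_measurable (lebesgue_on \<Omega>)"
  using assms by (intro measurable_restrict_space1 borel_measurable_indicator) auto

section \<open>The inclusions between the families of balls\<close>

theorem theorem1:
  fixes \<Omega> D :: "(real ^ 'n) set"
    and \<Lambda>\<^sub>h :: "real \<Rightarrow> (real ^ 'n \<Rightarrow> real) \<Rightarrow> (real ^ 'n \<Rightarrow> real) \<Rightarrow> real ^ 'n \<Rightarrow> real"
    and N :: "real \<Rightarrow> (real ^ 'n \<Rightarrow> real) \<Rightarrow> real ^ 'n \<Rightarrow> real"
    and \<omega> :: "real \<Rightarrow> real"
    and \<gamma>\<^sub>0 \<kappa> \<gamma> :: "real ^ 'n \<Rightarrow> real"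
    and \<beta> :: real
    and \<alpha> :: "real \<Rightarrow> real \<Rightarrow> real"
    and T :: "(real ^ 'n) set \<Rightarrow> (real ^ 'n \<Rightarrow> real) \<Rightarrow> real ^ 'n \<Rightarrow> real"
    and T\<^sub>h :: "real \<Rightarrow> (real ^ 'n) set \<Rightarrow> (real ^ 'n \<Rightarrow> real) \<Rightarrow> real ^ 'n \<Rightarrow> real"
    and T\<^sub>h\<^sub>\<delta> :: "real \<Rightarrow> real \<Rightarrow> (real ^ 'n) set \<Rightarrow> (real ^ 'n \<Rightarrow> real) \<Rightarrow> real ^ 'n \<Rightarrow> real"
  assumes dim: "CARD('n) \<in> {2, 3}"
    and domain: "bounded_lipschitz_domain \<Omega>"
    and model_compact: "\<And>h w. h > 0 \<Longrightarrow> w \<in> Linf_plus \<Omega> \<Longrightarrow> compact_op (surface \<Omega>) (\<Lambda>\<^sub>h h w)"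
    and model_self_adjoint:
      "\<And>h w. h > 0 \<Longrightarrow> w \<in> Linf_plus \<Omega> \<Longrightarrow> self_adjoint (surface \<Omega>) (\<Lambda>\<^sub>h h w)"
    and model_AE: "\<And>h w w' f. h > 0 \<Longrightarrow> w \<in> Linf_plus \<Omega> \<Longrightarrow> w' \<in> Linf_plus \<Omega> \<Longrightarrow>
        (AE x in lebesgue_on \<Omega>. w x = w' x) \<Longrightarrow> f \<in> L2_diamond (surface \<Omega>) \<Longrightarrow>
        (AE x in surface \<Omega>. \<Lambda>\<^sub>h h w f x = \<Lambda>\<^sub>h h w' f x)"
    and model_error: "\<And>h w. h > 0 \<Longrightarrow> w \<in> Linf_plus \<Omega> \<Longrightarrow>
        bounded_op (surface \<Omega>) (\<lambda>f x. NtD \<Omega> w f x - \<Lambda>\<^sub>h h w f x) \<and>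
        op_norm (surface \<Omega>) (\<lambda>f x. NtD \<Omega> w f x - \<Lambda>\<^sub>h h w f x)
          \<le> \<omega> h * Linf_norm (lebesgue_on \<Omega>) w"
    and error_lim: "(\<omega> \<longlongrightarrow> 0) (at_right 0)"
    and noise_compact: "\<And>\<delta>. \<delta> > 0 \<Longrightarrow> compact_op (surface \<Omega>) (N \<delta>)"
    and noise_self_adjoint: "\<And>\<delta>. \<delta> > 0 \<Longrightarrow> self_adjoint (surface \<Omega>) (N \<delta>)"
    and noise_bound: "\<And>\<delta>. \<delta> > 0 \<Longrightarrow> op_norm (surface \<Omega>) (N \<delta>) \<le> \<delta>"
    and gamma0: "smooth_on_closure \<Omega> \<gamma>\<^sub>0" "\<gamma>\<^sub>0 \<in> Linf_plus \<Omega>"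
    and kappa: "\<kappa> \<in> Linf_plus \<Omega>"
    and inclusion: "open D" "closure D \<subseteq> \<Omega>"
    and gamma: "\<gamma> = (\<lambda>x. \<gamma>\<^sub>0 x + \<kappa> x * indicator D x)"
    and beta: "\<beta> > 0"
    and T: "T = (\<lambda>B f x. NtD \<Omega> (\<lambda>y. \<gamma>\<^sub>0 y + \<beta> * indicator B y) f x - NtD \<Omega> \<gamma> f x)"
    and T\<^sub>h: "T\<^sub>h = (\<lambda>h B f x. \<Lambda>\<^sub>h h (\<lambda>y. \<gamma>\<^sub>0 y + \<beta> * indicator B y) f x - \<Lambda>\<^sub>h h \<gamma> f x)"
    and T\<^sub>h\<^sub>\<delta>: "T\<^sub>h\<^sub>\<delta> = (\<lambda>h \<delta> B f x.
        \<Lambda>\<^sub>h h (\<lambda>y. \<gamma>\<^sub>0 y + \<beta> * indicator B y) f x - (\<Lambda>\<^sub>h h \<gamma> f x + N \<delta> f x))"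
    and alpha_bound: "\<And>h \<delta>. h > 0 \<Longrightarrow> \<delta> > 0 \<Longrightarrow>
        ereal (\<delta> - \<alpha> h \<delta>)
          \<le> (INF B\<in>psd_balls \<Omega> 0 T. INF s\<in>spectrum (surface \<Omega>) (T\<^sub>h h B). ereal s)"
    and alpha_lim: "((\<lambda>(h, \<delta>). \<alpha> h \<delta>) \<longlongrightarrow> 0) (at_right 0 \<times>\<^sub>F at_right 0)"
  shows "\<forall>lam>0. \<exists>\<epsilon>>0. \<forall>h\<in>{0<..\<epsilon>}. \<forall>\<delta>\<in>{0<..\<epsilon>}.
           psd_balls \<Omega> 0 T \<subseteq> psd_balls \<Omega> (\<alpha> h \<delta>) (T\<^sub>h\<^sub>\<delta> h \<delta>) \<and>
           psd_balls \<Omega> (\<alpha> h \<delta>) (T\<^sub>h\<^sub>\<delta> h \<delta>) \<subseteq> psd_balls \<Omega> lam T"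
proof (intro allI impI)
  fix lam :: real assume lam: "lam > 0"
  let ?M = "surface \<Omega>" and ?L = "lebesgue_on \<Omega>"
  let ?\<gamma>B = "\<lambda>B y. \<gamma>\<^sub>0 y + \<beta> * indicator B y"
  obtain C where C: "C \<ge> 0" "AE x in ?L. \<bar>\<gamma>\<^sub>0 x\<bar> \<le> C"
    using gamma0(2) Linf_AE_bound[of \<gamma>\<^sub>0 ?L] by (auto simp: Linf_plus_def)
  obtain K where K: "K \<ge> 0" "AE x in ?L. \<bar>\<kappa> x\<bar> \<le> K"
    using kappa Linf_AE_bound[of \<kappa> ?L] by (auto simp: Linf_plus_def)
  have "AE x in ?L. 0 \<le> \<kappa> x * indicator D x \<and> \<kappa> x * indicator D x \<le> K"
    using Linf_plus_AE_nonneg[OF kappa] K(2)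
    by eventually_elim (use K(1) in \<open>auto simp: indicator_def\<close>)
  moreover have "(\<lambda>x. \<kappa> x * indicator D x) \<in> borel_measurable ?L"
    using kappa indicator_borel_measurable_lebesgue_on[OF inclusion(1)]
    by (auto simp: Linf_plus_def Linf_def)
  ultimately have \<gamma>_plus: "\<gamma> \<in> Linf_plus \<Omega>" and \<gamma>_norm: "Linf_norm ?L \<gamma> \<le> C + K"
    unfolding gamma using Linf_plus_add_nonneg[OF gamma0(2) C(2) _ _ C(1) K(1)] by blast+
  \<comment> \<open>The bound does not depend on B; this is what makes the final \<epsilon> uniform
    over all balls.\<close>
  have \<gamma>B: "?\<gamma>B B \<in> Linf_plus \<Omega> \<and> Linf_norm ?L (?\<gamma>B B) \<le> C + \<beta>"
    if "open B" for B
  proof -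
    have "(\<lambda>y. \<beta> * indicator B y) \<in> borel_measurable ?L"
      using indicator_borel_measurable_lebesgue_on[OF that] by auto
    moreover have "AE x in ?L. 0 \<le> \<beta> * indicator B x \<and> \<beta> * indicator B x \<le> \<beta>"
      using beta by (auto simp: indicator_def)
    ultimately show ?thesis
      using Linf_plus_add_nonneg[OF gamma0(2) C(2) _ _ C(1), of _ \<beta>] beta by auto
  qed
  have model_bounded: "bounded_op ?M (\<Lambda>\<^sub>h h w)" if "h > 0" "w \<in> Linf_plus \<Omega>" for h w
    using model_compact[OF that] by (simp add: compact_op_def)
  have N_bounded: "bounded_op ?M (N \<delta>)" if "\<delta> > 0" for \<delta>
    using noise_compact[OF that] by (simp add: compact_op_def)
  have N_form: "\<bar>L2_inner ?M (N \<delta> f) f\<bar> \<le> \<delta> * (L2_norm ?M f)\<^sup>2"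
    if "\<delta> > 0" "f \<in> L2_diamond ?M" for \<delta> f
    using that by (intro L2_inner_op_abs_le N_bounded noise_bound)
  \<comment> \<open>The absolute value of \<omega> h makes the estimate monotone in the norm bound,
    whatever the sign of \<omega> h.\<close>
  have err_form: "\<bar>L2_inner ?M (\<lambda>x. NtD \<Omega> w f x - \<Lambda>\<^sub>h h w f x) f\<bar> \<le> \<bar>\<omega> h\<bar> * b * (L2_norm ?M f)\<^sup>2"
    if "h > 0" "w \<in> Linf_plus \<Omega>" "Linf_norm ?L w \<le> b" "0 \<le> b" "f \<in> L2_diamond ?M" for h w f b
  proof (rule L2_inner_op_abs_le[of ?M "\<lambda>f x. NtD \<Omega> w f x - \<Lambda>\<^sub>h h w f x"])
    have n: "0 \<le> Linf_norm ?L w"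
      using that(2) by (intro Linf_norm_nonneg) (simp add: Linf_plus_def)
    have "op_norm ?M (\<lambda>f x. NtD \<Omega> w f x - \<Lambda>\<^sub>h h w f x) \<le> \<omega> h * Linf_norm ?L w"
      using model_error[OF that(1,2)] by blast
    also have "\<dots> \<le> \<bar>\<omega> h\<bar> * b"
      using n that by (intro mult_mono) auto
    finally show "op_norm ?M (\<lambda>f x. NtD \<Omega> w f x - \<Lambda>\<^sub>h h w f x) \<le> \<bar>\<omega> h\<bar> * b" .
  qed (use model_error[OF that(1,2)] that(5) in simp_all)

  \<comment> \<open>This is (C + \<beta>) + (C + K), the sum of the norm bounds of the two
    conductivities whose model errors separate \<open>T\<close> from \<open>T\<^sub>h\<close>. Model
    errors, \<alpha> and \<delta> each receive a third of \<open>lam\<close>.\<close>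
  define b where "b = 2 * C + K + \<beta>"
  have "eventually (\<lambda>h. \<bar>\<omega> h\<bar> * b < lam / 3) (at_right 0)"
  proof -
    have "((\<lambda>h. \<bar>\<omega> h\<bar> * b) \<longlongrightarrow> \<bar>0\<bar> * b) (at_right 0)"
      by (intro tendsto_intros error_lim)
    then show ?thesis using lam by (intro order_tendstoD) auto
  qed
  then obtain e1 where e1: "e1 > 0" "\<And>h. 0 < h \<Longrightarrow> h < e1 \<Longrightarrow> \<bar>\<omega> h\<bar> * b < lam / 3"
    by (auto simp: eventually_at_right_field)
  have "eventually (\<lambda>(h, \<delta>). \<alpha> h \<delta> < lam / 3) (at_right 0 \<times>\<^sub>F at_right 0)"
    using order_tendstoD(2)[OF alpha_lim, of "lam / 3"] lam by (simp add: case_prod_unfold)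
  \<comment> \<open>An event of the product filter contains a product, which separates the
    conditions on h and \<delta>.\<close>
  then obtain P Q where PQ: "eventually P (at_right 0)" "eventually Q (at_right 0)"
    "\<And>h \<delta>. P h \<Longrightarrow> Q \<delta> \<Longrightarrow> \<alpha> h \<delta> < lam / 3"
    by (auto simp: eventually_prod_filter)
  obtain e2 where e2: "e2 > 0" "\<And>h. 0 < h \<Longrightarrow> h < e2 \<Longrightarrow> P h"
    using PQ(1) by (auto simp: eventually_at_right_field)
  obtain e3 where e3: "e3 > 0" "\<And>h. 0 < h \<Longrightarrow> h < e3 \<Longrightarrow> Q h"
    using PQ(2) by (auto simp: eventually_at_right_field)
  \<comment> \<open>Dividing by 3 keeps the closed endpoint \<epsilon> strictly below
    \<open>e1\<close>, \<open>e2\<close>, \<open>e3\<close> and also gives \<delta> \<le> lam /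
    3.\<close>
  define \<epsilon> where "\<epsilon> = Min {e1, e2, e3, lam} / 3"
  have \<epsilon>: "\<epsilon> > 0" "\<epsilon> < e1" "\<epsilon> < e2" "\<epsilon> < e3" "\<epsilon> \<le> lam / 3"
    using e1(1) e2(1) e3(1) lam by (auto simp: \<epsilon>_def)

  \<comment> \<open>Both forms are reduced to that of \<open>T\<^sub>h\<close>. The
    Neumann-to-Dirichlet maps enter only through their differences from the models, which are
    bounded operators by \<open>model_error\<close>.\<close>
  have form: "L2_inner ?M (\<lambda>x. T\<^sub>h\<^sub>\<delta> h \<delta> B f x + a * f x) f
      = L2_inner ?M (T\<^sub>h h B f) f - L2_inner ?M (N \<delta> f) f + a * (L2_norm ?M f)\<^sup>2"
    and form_T: "L2_inner ?M (\<lambda>x. T B f x + c * f x) f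
      = L2_inner ?M (T\<^sub>h h B f) f + c * (L2_norm ?M f)\<^sup>2
        + L2_inner ?M (\<lambda>x. NtD \<Omega> (?\<gamma>B B) f x - \<Lambda>\<^sub>h h (?\<gamma>B B) f x) f
        - L2_inner ?M (\<lambda>x. NtD \<Omega> \<gamma> f x - \<Lambda>\<^sub>h h \<gamma> f x) f"
    if h: "h > 0" and \<delta>: "\<delta> > 0" and B: "open B" and f: "f \<in> L2_diamond ?M" for h \<delta> B f a c
  proof -
    note \<gamma>B = \<gamma>B[OF B, THEN conjunct1]
    let ?e = "\<lambda>w f x. NtD \<Omega> w f x - \<Lambda>\<^sub>h h w f x"
    have L2: "f \<in> L2 ?M" "N \<delta> f \<in> L2 ?M" "T\<^sub>h h B f \<in> L2 ?M" "?e (?\<gamma>B B) f \<in> L2 ?M" "?e \<gamma> f \<in> L2 ?M"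
      unfolding T\<^sub>h
      using f bounded_opD(1)[OF N_bounded[OF \<delta>] f]
        bounded_opD(1)[OF bounded_op_diff[OF model_bounded[OF h \<gamma>B] model_bounded[OF h \<gamma>_plus]] f]
        bounded_opD(1)[OF model_error[OF h \<gamma>B, THEN conjunct1] f]
        bounded_opD(1)[OF model_error[OF h \<gamma>_plus, THEN conjunct1] f]
      by (simp_all add: L2_diamond_L2)
    have lin: "L2_inner ?M (\<lambda>x. u x + a * v x) f = L2_inner ?M u f + a * L2_inner ?M v f"
      and diff: "L2_inner ?M (\<lambda>x. u x - v x) f = L2_inner ?M u f - L2_inner ?M v f"
      and lin_L2: "(\<lambda>x. u x + a * v x) \<in> L2 ?M" and diff_L2: "(\<lambda>x. u x - v x) \<in> L2 ?M"
      if "u \<in> L2 ?M" "v \<in> L2 ?M" for u v a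
      using L2_inner_lincomb_left[OF that L2(1), of 1 a] L2_lincomb[OF that, of 1 a]
        L2_inner_lincomb_left[OF that L2(1), of 1 "-1"] L2_lincomb[OF that, of 1 "-1"] by simp_all
    have "(\<lambda>x. T\<^sub>h\<^sub>\<delta> h \<delta> B f x + a * f x) = (\<lambda>x. (T\<^sub>h h B f x - N \<delta> f x) + a * f x)"
      by (simp add: T\<^sub>h\<^sub>\<delta> T\<^sub>h fun_eq_iff)
    then show "L2_inner ?M (\<lambda>x. T\<^sub>h\<^sub>\<delta> h \<delta> B f x + a * f x) f
      = L2_inner ?M (T\<^sub>h h B f) f - L2_inner ?M (N \<delta> f) f + a * (L2_norm ?M f)\<^sup>2"
      by (simp only: lin[OF diff_L2[OF L2(3,2)] L2(1)] diff[OF L2(3,2)] L2_inner_self)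
    \<comment> \<open>T(B) is \<open>T\<^sub>h\<close> plus the model error at the test conductivity
      minus the model error at \<gamma>.\<close>
    have "(\<lambda>x. T B f x + c * f x) = (\<lambda>x. (T\<^sub>h h B f x + c * f x) + 1 * (?e (?\<gamma>B B) f x - ?e \<gamma> f x))"
      by (simp add: T T\<^sub>h fun_eq_iff)
    then show "L2_inner ?M (\<lambda>x. T B f x + c * f x) f
      = L2_inner ?M (T\<^sub>h h B f) f + c * (L2_norm ?M f)\<^sup>2
        + L2_inner ?M (?e (?\<gamma>B B) f) f - L2_inner ?M (?e \<gamma> f) f"
      by (simp only: lin[OF lin_L2[OF L2(3,1)] diff_L2[OF L2(4,5)]] lin[OF L2(3,1)]
          diff[OF L2(4,5)] L2_inner_self) simp
  qed

  show "\<exists>\<epsilon>>0. \<forall>h\<in>{0<..\<epsilon>}. \<forall>\<delta>\<in>{0<..\<epsilon>}.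
           psd_balls \<Omega> 0 T \<subseteq> psd_balls \<Omega> (\<alpha> h \<delta>) (T\<^sub>h\<^sub>\<delta> h \<delta>) \<and>
           psd_balls \<Omega> (\<alpha> h \<delta>) (T\<^sub>h\<^sub>\<delta> h \<delta>) \<subseteq> psd_balls \<Omega> lam T"
  proof (intro exI[of _ \<epsilon>] conjI ballI subsetI \<epsilon>(1))

    \<comment> \<open>First inclusion: the spectral bound absorbs the noise\<close>
    fix h \<delta> B
    assume "h \<in> {0<..\<epsilon>}" "\<delta> \<in> {0<..\<epsilon>}" and BT: "B \<in> psd_balls \<Omega> 0 T"
    then have h: "h > 0" and \<delta>: "\<delta> > 0" by auto
    have B: "open B" using BT by (auto simp: psd_balls_def)
    note \<gamma>B = \<gamma>B[OF B, THEN conjunct1]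
    have bounded: "bounded_op ?M (T\<^sub>h h B)"
      unfolding T\<^sub>h by (intro bounded_op_diff model_bounded h \<gamma>B \<gamma>_plus)
    have adjoint: "self_adjoint ?M (T\<^sub>h h B)"
      using self_adjoint_lincomb[OF model_bounded[OF h \<gamma>B] model_self_adjoint[OF h \<gamma>B]
          model_bounded[OF h \<gamma>_plus] model_self_adjoint[OF h \<gamma>_plus], of 1 "-1"]
      by (simp add: T\<^sub>h)
    \<comment> \<open>Positivity of T(B) places B in the range of the outer infimum, so the bound on
      \<alpha> reaches every spectral value of this \<open>T\<^sub>h h B\<close>.\<close>
    have spec: "\<delta> - \<alpha> h \<delta> \<le> s" if "s \<in> spectrum ?M (T\<^sub>h h B)" for s
    proof -
      have "ereal (\<delta> - \<alpha> h \<delta>) \<le> ereal s"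
        by (rule order_trans[OF alpha_bound[OF h \<delta>]]) (intro INF_lower2[OF BT] INF_lower that)
      then show ?thesis by simp
    qed
    \<comment> \<open>Per unit of the squared norm, the form is at least (\<delta> - \<alpha>) -
      \<delta> + \<alpha> = 0.\<close>
    have "0 \<le> L2_inner ?M (\<lambda>x. T\<^sub>h\<^sub>\<delta> h \<delta> B f x + \<alpha> h \<delta> * f x) f" if f: "f \<in> L2_diamond ?M" for f
      using spectrum_lower_bound_form[OF bounded adjoint spec f] N_form[OF \<delta> f]
      unfolding form[OF h \<delta> B f] by (simp add: algebra_simps abs_le_iff)
    then show "B \<in> psd_balls \<Omega> (\<alpha> h \<delta>) (T\<^sub>h\<^sub>\<delta> h \<delta>)"
      using BT by (simp add: psd_balls_def pos_semidef_def)
  next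

    \<comment> \<open>Second inclusion: all perturbations together cost at most
      \<open>lam\<close>\<close>
    fix h \<delta> B
    assume h\<delta>: "h \<in> {0<..\<epsilon>}" "\<delta> \<in> {0<..\<epsilon>}" and BT: "B \<in> psd_balls \<Omega> (\<alpha> h \<delta>) (T\<^sub>h\<^sub>\<delta> h \<delta>)"
    then have h: "h > 0" and \<delta>: "\<delta> > 0" by auto
    have B: "open B" using BT by (auto simp: psd_balls_def)
    have small: "\<alpha> h \<delta> + \<delta> + \<bar>\<omega> h\<bar> * b \<le> lam"
    proof -
      have "\<bar>\<omega> h\<bar> * b < lam / 3" using h\<delta> \<epsilon> by (intro e1) auto
      moreover have "\<alpha> h \<delta> < lam / 3" using h\<delta> \<epsilon> by (intro PQ(3) e2 e3) auto
      moreover have "\<delta> \<le> lam / 3" using h\<delta> \<epsilon> by auto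
      ultimately show ?thesis by linarith
    qed
    have "0 \<le> L2_inner ?M (\<lambda>x. T B f x + lam * f x) f" if f: "f \<in> L2_diamond ?M" for f
    proof -
      let ?n = "(L2_norm ?M f)\<^sup>2"
      \<comment> \<open>Membership of B bounds the form of \<open>T\<^sub>h\<close> below by
        -(\<alpha> + \<delta>) times the squared norm. The two model errors subtract at most
        \<bar>\<omega> h\<bar> b times it, and \<open>small\<close> compares the total with
        \<open>lam\<close>.\<close>
      have "0 \<le> L2_inner ?M (T\<^sub>h h B f) f - L2_inner ?M (N \<delta> f) f + \<alpha> h \<delta> * ?n"
        using BT f by (simp add: psd_balls_def pos_semidef_def form[OF h \<delta> B f, symmetric])
      moreover note N_form[OF \<delta> f]
      moreover have "\<bar>L2_inner ?M (\<lambda>x. NtD \<Omega> (?\<gamma>B B) f x - \<Lambda>\<^sub>h h (?\<gamma>B B) f x) f\<bar> \<le> \<bar>\<omega> h\<bar> * (C + \<beta>) * ?n"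
        using \<gamma>B[OF B] C(1) beta by (intro err_form h f) auto
      moreover have "\<bar>L2_inner ?M (\<lambda>x. NtD \<Omega> \<gamma> f x - \<Lambda>\<^sub>h h \<gamma> f x) f\<bar> \<le> \<bar>\<omega> h\<bar> * (C + K) * ?n"
        using C(1) K(1) by (intro err_form h f \<gamma>_plus \<gamma>_norm) auto
      moreover have "(\<alpha> h \<delta> + \<delta> + \<bar>\<omega> h\<bar> * b) * ?n \<le> lam * ?n"
        by (intro mult_right_mono small) simp
      moreover have "(\<alpha> h \<delta> + \<delta> + \<bar>\<omega> h\<bar> * b) * ?n
          = \<alpha> h \<delta> * ?n + \<delta> * ?n + \<bar>\<omega> h\<bar> * (C + \<beta>) * ?n + \<bar>\<omega> h\<bar> * (C + K) * ?n"
        by (simp add: b_def algebra_simps)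
      ultimately show ?thesis
        unfolding form_T[OF h \<delta> B f] by linarith
    qed
    then show "B \<in> psd_balls \<Omega> lam T"
      using BT by (simp add: psd_balls_def pos_semidef_def)
  qed
qed

end
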